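(* Let $R$ be a commutative ring, let $\mathcal A$ be an associative $R$-algebra with center $Z(\mathcal A)$, and let $(\mathcal A[[\nu]],\star)$ be a formal deformation of $\mathcal A$. Let $\mathcal H_\nu:=Z(\mathcal A)+\nu\mathcal A[[\nu]]$, equipped with the product $\star$ and the rescaled bracket $[A,B]_\nu:=\frac1\nu(A\star B-B\star A)$, which makes $\mathcal H_\nu$ into a Poisson algebra. Then: (1) $\nu\mathcal H_\nu$ is a Poisson ideal of $(\mathcal H_\nu,[\cdot,\cdot]_\nu)$; (2) the quotient algebra $\mathcal H_\nu/\nu\mathcal H_\nu$ (with the induced product and bracket) is a commutative Poisson algebra.
   Context: Associative algebras are unital and not necessarily commutative. A (not necessarily commutative) Poisson algebra over a commutative ring $S$ is an associative $S$-algebra $\mathcal B$ with a skew-symmetric $S$-bilinear map $\{\cdot,\cdot\}:\mathcal B\times\mathcal B\to\mathcal B$ satisfying the Jacobi identity and the Leibniz identity $\{a,bc\}=\{a,b\}c+b\{a,c\}$; it is called commutative when the associative algebra $\mathcal B$ is commutative. A Poisson ideal is a two-sided ideal of the associative algebra which is also a Lie ideal for the bracket; the quotient is then a Poisson algebra. Formal deformation: $\mathcal A[[\nu]]$ is the $R[[\nu]]$-module of formal power series in $\nu$ with coefficients in $\mathcal A$. A formal deformation of $\mathcal A$ is an associative $R[[\nu]]$-algebra structure $\star$ on $\mathcal A[[\nu]]$ such that $a\star b-ab\in\nu\mathcal A[[\nu]]$ for all $a,b\in\mathcal A$. $\mathcal H_\nu$ consists of the power series whose constant term belongs to $Z(\mathcal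 A)$; it is a subalgebra of $(\mathcal A[[\nu]],\star)$, and $A\star B-B\star A\in\nu\mathcal H_\nu$ for $A,B\in\mathcal H_\nu$, so that $[\cdot,\cdot]_\nu$ is well defined with values in $\mathcal H_\nu$. *)

theory Defs
  imports "HOL-Algebra.Module" "HOL-Algebra.QuotRing"
begin

section \<open>Associative algebras and Poisson algebras\<close>

text \<open>The library locale \<^locale>\<open>algebra\<close> only covers commutative algebras.\<close>

locale assoc_algebra = module R M + ring M for R (structure) and M (structure) +
  assumes smult_mult_left:
      "\<lbrakk>r \<in> carrier R; x \<in> carrier M; y \<in> carrier M\<rbrakk> \<Longrightarrow>
       (r \<odot>\<^bsub>M\<^esub> x) \<otimes>\<^bsub>M\<^esub> y = r \<odot>\<^bsub>M\<^esub> (x \<otimes>\<^bsub>M\<^esub> y)"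
    and smult_mult_right:
      "\<lbrakk>r \<in> carrier R; x \<in> carrier M; y \<in> carrier M\<rbrakk> \<Longrightarrow>
       x \<otimes>\<^bsub>M\<^esub> (r \<odot>\<^bsub>M\<^esub> y) = r \<odot>\<^bsub>M\<^esub> (x \<otimes>\<^bsub>M\<^esub> y)"

definition ring_center :: "('a, 'm) ring_scheme \<Rightarrow> 'a set" where
  "ring_center A = {z \<in> carrier A. \<forall>x\<in>carrier A. z \<otimes>\<^bsub>A\<^esub> x = x \<otimes>\<^bsub>A\<^esub> z}"

locale poisson_algebra = assoc_algebra S B for S (structure) and B (structure) +
  fixes br
  assumes br_closed:
      "\<lbrakk>a \<in> carrier B; b \<in> carrier B\<rbrakk> \<Longrightarrow> br a b \<in> carrier B"
    and br_add_left:
      "\<lbrakk>a \<in> carrier B; b \<in> carrier B; c \<in> carrier B\<rbrakk> \<Longrightarrow>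
       br (a \<oplus>\<^bsub>B\<^esub> b) c = br a c \<oplus>\<^bsub>B\<^esub> br b c"
    and br_add_right:
      "\<lbrakk>a \<in> carrier B; b \<in> carrier B; c \<in> carrier B\<rbrakk> \<Longrightarrow>
       br a (b \<oplus>\<^bsub>B\<^esub> c) = br a b \<oplus>\<^bsub>B\<^esub> br a c"
    and br_smult_left:
      "\<lbrakk>s \<in> carrier S; a \<in> carrier B; b \<in> carrier B\<rbrakk> \<Longrightarrow>
       br (s \<odot>\<^bsub>B\<^esub> a) b = s \<odot>\<^bsub>B\<^esub> br a b"
    and br_smult_right:
      "\<lbrakk>s \<in> carrier S; a \<in> carrier B; b \<in> carrier B\<rbrakk> \<Longrightarrow>
       br a (s \<odot>\<^bsub>B\<^esub> b) = s \<odot>\<^bsub>B\<^esub> br a b"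
    and br_skew:
      "\<lbrakk>a \<in> carrier B; b \<in> carrier B\<rbrakk> \<Longrightarrow> br a b = \<ominus>\<^bsub>B\<^esub> br b a"
    and br_jacobi:
      "\<lbrakk>a \<in> carrier B; b \<in> carrier B; c \<in> carrier B\<rbrakk> \<Longrightarrow>
       br a (br b c) \<oplus>\<^bsub>B\<^esub> br b (br c a) \<oplus>\<^bsub>B\<^esub> br c (br a b) = \<zero>\<^bsub>B\<^esub>"
    and br_leibniz:
      "\<lbrakk>a \<in> carrier B; b \<in> carrier B; c \<in> carrier B\<rbrakk> \<Longrightarrow>
       br a (b \<otimes>\<^bsub>B\<^esub> c) = br a b \<otimes>\<^bsub>B\<^esub> c \<oplus>\<^bsub>B\<^esub> b \<otimes>\<^bsub>B\<^esub> br a c"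

locale comm_poisson_algebra = poisson_algebra S B br
  for S (structure) and B (structure) and br +
  assumes mult_comm:
      "\<lbrakk>a \<in> carrier B; b \<in> carrier B\<rbrakk> \<Longrightarrow> a \<otimes>\<^bsub>B\<^esub> b = b \<otimes>\<^bsub>B\<^esub> a"

locale poisson_ideal = poisson_algebra S B br + ideal I B
  for S (structure) and B (structure) and br and I +
  assumes lie_ideal: "\<lbrakk>b \<in> carrier B; x \<in> I\<rbrakk> \<Longrightarrow> br b x \<in> I"

text \<open>
  The structure induced on cosets, in the style of \<^const>\<open>rcoset_mult\<close>: the union over all
  representatives is a single coset exactly when the operation is well defined on cosets.
\<close>

definition quot_algebra ::
  "('s, 'b, 'm) module_scheme \<Rightarrow> 'b set \<Rightarrow> ('s, 'b set) module" where
  "quot_algebra B I =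
    \<lparr>carrier = carrier (B Quot I), mult = mult (B Quot I), one = one (B Quot I),
     zero = zero (B Quot I), add = add (B Quot I),
     smult = (\<lambda>s K. \<Union>x\<in>K. I +>\<^bsub>B\<^esub> (s \<odot>\<^bsub>B\<^esub> x))\<rparr>"

definition quot_bracket ::
  "('s, 'b, 'm) module_scheme \<Rightarrow> 'b set \<Rightarrow> ('b \<Rightarrow> 'b \<Rightarrow> 'b) \<Rightarrow> 'b set \<Rightarrow> 'b set \<Rightarrow> 'b set" where
  "quot_bracket B I br K L = (\<Union>x\<in>K. \<Union>y\<in>L. I +>\<^bsub>B\<^esub> br x y)"

section \<open>Formal power series and formal deformations\<close>

text \<open>
  A formal power series in \<open>\<nu>\<close> is the sequence of its coefficients.
  \<open>fps_ring R\<close> is $R[[\nu]]$ with the Cauchy product.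
\<close>

definition fps_const :: "('a, 'm) ring_scheme \<Rightarrow> 'a \<Rightarrow> nat \<Rightarrow> 'a" where
  "fps_const A a = (\<lambda>n. if n = 0 then a else \<zero>\<^bsub>A\<^esub>)"

definition fps_nu :: "('r, 'm) ring_scheme \<Rightarrow> nat \<Rightarrow> 'r" where
  "fps_nu R = (\<lambda>n. if n = 1 then \<one>\<^bsub>R\<^esub> else \<zero>\<^bsub>R\<^esub>)"

definition fps_ring :: "('r, 'm) ring_scheme \<Rightarrow> (nat \<Rightarrow> 'r) ring" where
  "fps_ring R =
    \<lparr>carrier = {f. \<forall>n. f n \<in> carrier R},
     mult = (\<lambda>f g n. \<Oplus>\<^bsub>R\<^esub>i\<in>{..n}. f i \<otimes>\<^bsub>R\<^esub> g (n - i)),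
     one = fps_const R \<one>\<^bsub>R\<^esub>,
     zero = (\<lambda>n. \<zero>\<^bsub>R\<^esub>),
     add = (\<lambda>f g n. f n \<oplus>\<^bsub>R\<^esub> g n)\<rparr>"

text \<open>
  The $R[[\nu]]$-module $A[[\nu]]$, equipped with a product \<open>star\<close> with unit \<open>e\<close>.
  The unit is a parameter because the unit of a formal deformation of \<open>A\<close> need not be
  the constant series \<open>\<one>\<^bsub>A\<^esub>\<close>.
\<close>

definition fps_algebra ::
  "('r, 'a, 'm) module_scheme \<Rightarrow> ((nat \<Rightarrow> 'a) \<Rightarrow> (nat \<Rightarrow> 'a) \<Rightarrow> nat \<Rightarrow> 'a) \<Rightarrow> (nat \<Rightarrow> 'a)
    \<Rightarrow> (nat \<Rightarrow> 'r, nat \<Rightarrow> 'a) module" where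
  "fps_algebra A star e =
    \<lparr>carrier = {F. \<forall>n. F n \<in> carrier A},
     mult = star,
     one = e,
     zero = (\<lambda>n. \<zero>\<^bsub>A\<^esub>),
     add = (\<lambda>F G n. F n \<oplus>\<^bsub>A\<^esub> G n),
     smult = (\<lambda>f F n. \<Oplus>\<^bsub>A\<^esub>i\<in>{..n}. f i \<odot>\<^bsub>A\<^esub> F (n - i))\<rparr>"

definition nu_multiples ::
  "('r, 'n) ring_scheme \<Rightarrow> (nat \<Rightarrow> 'r, 'b, 'm) module_scheme \<Rightarrow> 'b set \<Rightarrow> 'b set" where
  "nu_multiples R M V = (\<lambda>F. fps_nu R \<odot>\<^bsub>M\<^esub> F) ` V"

locale formal_deformation =
  assoc_algebra R A + star: assoc_algebra "fps_ring R" "fps_algebra A star e"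
  for R (structure) and A (structure) and star and e +
  assumes star_mod_nu:
    "\<lbrakk>a \<in> carrier A; b \<in> carrier A\<rbrakk> \<Longrightarrow>
     star (fps_const A a) (fps_const A b)
       \<ominus>\<^bsub>fps_algebra A star e\<^esub> fps_const A (a \<otimes>\<^bsub>A\<^esub> b)
     \<in> nu_multiples R (fps_algebra A star e) (carrier (fps_algebra A star e))"

section \<open>The Poisson algebra of series with central constant term\<close>

definition H_nu ::
  "('r, 'n) ring_scheme \<Rightarrow> ('r, 'a, 'm) module_scheme
    \<Rightarrow> ((nat \<Rightarrow> 'a) \<Rightarrow> (nat \<Rightarrow> 'a) \<Rightarrow> nat \<Rightarrow> 'a) \<Rightarrow> (nat \<Rightarrow> 'a) \<Rightarrow> (nat \<Rightarrow> 'r, nat \<Rightarrow> 'a) module" where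
  "H_nu R A star e = (let D = fps_algebra A star e in
     D\<lparr>carrier := (fps_const A ` ring_center A) <+>\<^bsub>D\<^esub> nu_multiples R D (carrier D)\<rparr>)"

definition nu_H_nu ::
  "('r, 'n) ring_scheme \<Rightarrow> ('r, 'a, 'm) module_scheme
    \<Rightarrow> ((nat \<Rightarrow> 'a) \<Rightarrow> (nat \<Rightarrow> 'a) \<Rightarrow> nat \<Rightarrow> 'a) \<Rightarrow> (nat \<Rightarrow> 'a) \<Rightarrow> (nat \<Rightarrow> 'a) set" where
  "nu_H_nu R A star e = nu_multiples R (H_nu R A star e) (carrier (H_nu R A star e))"

text \<open>
  \<open>bracket_nu\<close> is $\frac{1}{\nu}(F \star G - G \star F)$, where division by \<open>\<nu>\<close> is the
  unique solution of \<open>\<nu> C = F \<star> G - G \<star> F\<close> in $A[[\nu]]$.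
\<close>

definition bracket_nu ::
  "('r, 'n) ring_scheme \<Rightarrow> ('r, 'a, 'm) module_scheme
    \<Rightarrow> ((nat \<Rightarrow> 'a) \<Rightarrow> (nat \<Rightarrow> 'a) \<Rightarrow> nat \<Rightarrow> 'a) \<Rightarrow> (nat \<Rightarrow> 'a)
    \<Rightarrow> (nat \<Rightarrow> 'a) \<Rightarrow> (nat \<Rightarrow> 'a) \<Rightarrow> nat \<Rightarrow> 'a" where
  "bracket_nu R A star e F G = (let D = fps_algebra A star e in
     (THE C. C \<in> carrier D \<and> fps_nu R \<odot>\<^bsub>D\<^esub> C = star F G \<ominus>\<^bsub>D\<^esub> star G F))"

end

theory Submission
  imports Defs "HOL-Algebra.Subrings"
begin

text \<open>
  Multiplication by \<open>\<nu>\<close> on \<open>A[[\<nu>]]\<close> is injective, so every identity for the rescaled bracket can be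
  checked after multiplying by a power of \<open>\<nu>\<close>, where it becomes an identity between commutators.
  The quotient is commutative because \<open>F \<star> G - G \<star> F = \<nu> [F, G]\<^sub>\<nu>\<close> with \<open>[F, G]\<^sub>\<nu>\<close> in \<open>H\<^sub>\<nu>\<close>.
\<close>

section \<open>Quotients of Poisson algebras\<close>

text \<open>Evaluates the unions over coset representatives that define scalar action and bracket on
  the quotient, once independence of the representative is known.\<close>

lemma UN_eq_const:
  assumes "x0 \<in> K" "\<And>x. x \<in> K \<Longrightarrow> f x = c"
  shows "(\<Union>x\<in>K. f x) = c"
  using assms by auto

context poisson_ideal
begin

text \<open>A scalar \<open>s\<close> acts as left multiplication by \<open>s\<close> times the
  unit, so a two-sided ideal is automatically a submodule.\<close>

lemma ideal_smult_closed:
  assumes "s \<in> carrier S" "x \<in> I"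
  shows "s \<odot>\<^bsub>B\<^esub> x \<in> I"
proof -
  have "s \<odot>\<^bsub>B\<^esub> x = (s \<odot>\<^bsub>B\<^esub> \<one>\<^bsub>B\<^esub>) \<otimes>\<^bsub>B\<^esub> x"
    using assms a_Hcarr by (simp add: smult_mult_left)
  then show ?thesis
    using assms I_l_closed by simp
qed

lemma mem_coset:
  assumes "x' \<in> I +>\<^bsub>B\<^esub> x"
  obtains i where "i \<in> I" "x' = i \<oplus>\<^bsub>B\<^esub> x"
  using assms by (auto simp: a_r_coset_def')

lemma coset_absorb:
  assumes "i \<in> I" "x \<in> carrier B"
  shows "I +>\<^bsub>B\<^esub> (i \<oplus>\<^bsub>B\<^esub> x) = I +>\<^bsub>B\<^esub> x"
  using a_repr_independence'[of "i \<oplus>\<^bsub>B\<^esub> x" x] a_rcosI[OF assms(1) a_subset assms(2)] assms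
  by simp

lemma quot_smult_coset:
  assumes s: "s \<in> carrier S" and x: "x \<in> carrier B"
  shows "s \<odot>\<^bsub>quot_algebra B I\<^esub> (I +>\<^bsub>B\<^esub> x) = I +>\<^bsub>B\<^esub> (s \<odot>\<^bsub>B\<^esub> x)"
proof -
  have "(\<Union>x'\<in>I +>\<^bsub>B\<^esub> x. I +>\<^bsub>B\<^esub> (s \<odot>\<^bsub>B\<^esub> x')) = I +>\<^bsub>B\<^esub> (s \<odot>\<^bsub>B\<^esub> x)"
  proof (rule UN_eq_const[OF a_rcos_self[OF x]])
    fix x' assume "x' \<in> I +>\<^bsub>B\<^esub> x"
    then obtain i where i: "i \<in> I" "x' = i \<oplus>\<^bsub>B\<^esub> x" by (rule mem_coset)
    \<comment> \<open>Replacing \<open>x\<close> by \<open>i + x\<close> changes the multiple by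
      \<open>s\<close> times \<open>i\<close>, which stays in \<open>I\<close> and is absorbed by
      the coset.\<close>
    with s x show "I +>\<^bsub>B\<^esub> (s \<odot>\<^bsub>B\<^esub> x') = I +>\<^bsub>B\<^esub> (s \<odot>\<^bsub>B\<^esub> x)"
      by (simp add: smult_r_distr a_Hcarr coset_absorb ideal_smult_closed)
  qed
  then show ?thesis
    by (simp add: quot_algebra_def)
qed

lemma lie_ideal_left:
  assumes "x \<in> I" "b \<in> carrier B"
  shows "br x b \<in> I"
  using assms lie_ideal[of b x] br_skew[of x b] a_Hcarr by simp

lemma quot_bracket_coset:
  assumes x: "x \<in> carrier B" and y: "y \<in> carrier B"
  shows "quot_bracket B I br (I +>\<^bsub>B\<^esub> x) (I +>\<^bsub>B\<^esub> y) = I +>\<^bsub>B\<^esub> br x y"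
  unfolding quot_bracket_def
proof (rule UN_eq_const[OF a_rcos_self[OF x]], rule UN_eq_const[OF a_rcos_self[OF y]])
  fix x' y' assume "x' \<in> I +>\<^bsub>B\<^esub> x" "y' \<in> I +>\<^bsub>B\<^esub> y"
  then obtain i j where i: "i \<in> I" "x' = i \<oplus>\<^bsub>B\<^esub> x" and j: "j \<in> I" "y' = j \<oplus>\<^bsub>B\<^esub> y"
    by (metis mem_coset)
  have c: "i \<in> carrier B" "j \<in> carrier B"
    using i j a_Hcarr by auto
  \<comment> \<open>The first argument is expanded fully, the second only beside \<open>x\<close>;
    both error terms then have an entry in \<open>I\<close>, so the Lie ideal property disposes of
    them.\<close>
  have "br x' y' = br i (j \<oplus>\<^bsub>B\<^esub> y) \<oplus>\<^bsub>B\<^esub> (br x j \<oplus>\<^bsub>B\<^esub> br x y)"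
    using i j c x y by (simp add: br_add_left br_add_right[of x])
  moreover have "br i (j \<oplus>\<^bsub>B\<^esub> y) \<in> I" "br x j \<in> I"
    using i j c x y by (auto intro: lie_ideal_left lie_ideal)
  ultimately show "I +>\<^bsub>B\<^esub> br x' y' = I +>\<^bsub>B\<^esub> br x y"
    using c x y by (simp add: coset_absorb br_closed)
qed

lemma quot_carrierE:
  assumes "K \<in> carrier (quot_algebra B I)"
  obtains x where "x \<in> carrier B" "K = I +>\<^bsub>B\<^esub> x"
  using assms by (auto simp: quot_algebra_def FactRing_simps)

lemma quot_coset_closed:
  "x \<in> carrier B \<Longrightarrow> I +>\<^bsub>B\<^esub> x \<in> carrier (quot_algebra B I)"
  by (auto simp: quot_algebra_def FactRing_simps)

lemma quot_ops:
  "\<lbrakk>x \<in> carrier B; y \<in> carrier B\<rbrakk>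
    \<Longrightarrow> (I +>\<^bsub>B\<^esub> x) \<oplus>\<^bsub>quot_algebra B I\<^esub> (I +>\<^bsub>B\<^esub> y) = I +>\<^bsub>B\<^esub> (x \<oplus>\<^bsub>B\<^esub> y)"
  "\<lbrakk>x \<in> carrier B; y \<in> carrier B\<rbrakk>
    \<Longrightarrow> (I +>\<^bsub>B\<^esub> x) \<otimes>\<^bsub>quot_algebra B I\<^esub> (I +>\<^bsub>B\<^esub> y) = I +>\<^bsub>B\<^esub> (x \<otimes>\<^bsub>B\<^esub> y)"
  "\<zero>\<^bsub>quot_algebra B I\<^esub> = I +>\<^bsub>B\<^esub> \<zero>\<^bsub>B\<^esub>"
  "\<one>\<^bsub>quot_algebra B I\<^esub> = I +>\<^bsub>B\<^esub> \<one>\<^bsub>B\<^esub>"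
  by (simp_all add: quot_algebra_def FactRing_def a_rcos_sum rcoset_mult_add a_rcos_const)

lemmas quot_simps = quot_ops quot_coset_closed quot_smult_coset quot_bracket_coset

text \<open>Every element is a coset, and \<open>quot_simps\<close> moves each operation to
  representatives, so each axiom reduces to the same axiom in \<open>B\<close>.\<close>

lemma quot_ring: "ring (quot_algebra B I)"
proof (intro ringI abelian_groupI monoidI)
  fix K assume "K \<in> carrier (quot_algebra B I)"
  then obtain x where x: "x \<in> carrier B" "K = I +>\<^bsub>B\<^esub> x" by (rule quot_carrierE)
  then have "(I +>\<^bsub>B\<^esub> \<ominus>\<^bsub>B\<^esub> x) \<oplus>\<^bsub>quot_algebra B I\<^esub> K = \<zero>\<^bsub>quot_algebra B I\<^esub>"
    by (simp add: quot_simps M.l_neg)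
  then show "\<exists>L\<in>carrier (quot_algebra B I). L \<oplus>\<^bsub>quot_algebra B I\<^esub> K = \<zero>\<^bsub>quot_algebra B I\<^esub>"
    using x quot_coset_closed by blast
qed (auto elim!: quot_carrierE simp: quot_simps a_ac m_assoc l_distr r_distr)

lemma quot_module: "Module.module S (quot_algebra B I)"
proof (rule moduleI)
  show "abelian_group (quot_algebra B I)"
    using quot_ring by (rule ring.is_abelian_group)
qed (auto elim!: quot_carrierE
      simp: R.is_cring quot_simps smult_l_distr smult_r_distr smult_assoc1)

lemma quot_poisson_algebra:
  "poisson_algebra S (quot_algebra B I) (quot_bracket B I br)"
proof -
  interpret Q: ring "quot_algebra B I" by (rule quot_ring)
  have skew: "quot_bracket B I br K L = \<ominus>\<^bsub>quot_algebra B I\<^esub> quot_bracket B I br L K"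
    if K: "K \<in> carrier (quot_algebra B I)" and L: "L \<in> carrier (quot_algebra B I)" for K L
  proof -
    obtain x where x: "x \<in> carrier B" "K = I +>\<^bsub>B\<^esub> x"
      using K by (rule quot_carrierE)
    obtain y where y: "y \<in> carrier B" "L = I +>\<^bsub>B\<^esub> y"
      using L by (rule quot_carrierE)
    \<comment> \<open>Negation in the quotient is not computed on representatives by
      \<open>quot_simps\<close>; skew-symmetry is therefore put as a vanishing sum, and uniqueness
      of additive inverses does the rest.\<close>
    from x y have "br x y \<oplus>\<^bsub>B\<^esub> br y x = \<zero>\<^bsub>B\<^esub>"
      using br_skew[of x y] by (simp add: br_closed M.l_neg)
    then show ?thesis
      using x y by (intro Q.minus_equality[symmetric]) (simp_all add: quot_simps br_closed)
  qed
  show ?thesis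
    by (intro poisson_algebra.intro assoc_algebra.intro assoc_algebra_axioms.intro
        poisson_algebra_axioms.intro quot_module quot_ring skew)
      (auto elim!: quot_carrierE simp: quot_simps smult_mult_left smult_mult_right
        br_closed br_add_left br_add_right br_smult_left br_smult_right br_jacobi br_leibniz)
qed

end

section \<open>Commutators divisible by a central parameter\<close>

context ring
begin

lemma commutator_skew:
  assumes "x \<in> carrier R" "y \<in> carrier R"
  shows "\<ominus> (y \<otimes> x \<ominus> x \<otimes> y) = x \<otimes> y \<ominus> y \<otimes> x"
  using assms by (simp add: a_minus_def minus_add a_ac)

lemma commutator_add_right:
  assumes "x \<in> carrier R" "y \<in> carrier R" "z \<in> carrier R"
  shows "x \<otimes> y \<ominus> y \<otimes> x \<oplus> (x \<otimes> z \<ominus> z \<otimes> x) = x \<otimes> (y \<oplus> z) \<ominus> (y \<oplus> z) \<otimes> x"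
  using assms by (simp add: a_minus_def minus_add l_distr r_distr a_ac)

text \<open>After expansion the product \<open>y x z\<close> occurs once with each sign;
  \<open>r_neg1\<close> and \<open>r_neg2\<close> cancel such pairs.\<close>

lemma commutator_leibniz:
  assumes "x \<in> carrier R" "y \<in> carrier R" "z \<in> carrier R"
  shows "(x \<otimes> y \<ominus> y \<otimes> x) \<otimes> z \<oplus> y \<otimes> (x \<otimes> z \<ominus> z \<otimes> x)
    = x \<otimes> (y \<otimes> z) \<ominus> (y \<otimes> z) \<otimes> x"
  using assms
  by (simp add: a_minus_def minus_add l_distr r_distr l_minus r_minus a_ac m_assoc r_neg1 r_neg2)

lemma commutator_jacobi:
  fixes c
  assumes "x \<in> carrier R" "y \<in> carrier R" "z \<in> carrier R"
  defines "c \<equiv> \<lambda>u v. u \<otimes> v \<ominus> v \<otimes> u"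
  shows "c x (c y z) \<oplus> c y (c z x) \<oplus> c z (c x y) = \<zero>"
proof -
  \<comment> \<open>The sum of the products of \<open>x\<close>, \<open>y\<close>, \<open>z\<close>
    in all six orders. The twelve terms of the expanded left-hand side contain each order once with
    each sign.\<close>
  let ?s = "x \<otimes> (y \<otimes> z) \<oplus> x \<otimes> (z \<otimes> y) \<oplus> y \<otimes> (x \<otimes> z) \<oplus> y \<otimes> (z \<otimes> x)
    \<oplus> z \<otimes> (x \<otimes> y) \<oplus> z \<otimes> (y \<otimes> x)"
  have "c x (c y z) \<oplus> c y (c z x) \<oplus> c z (c x y) = ?s \<oplus> \<ominus> ?s"
    using assms(1-3) unfolding c_def
    by (simp add: a_minus_def minus_add l_distr r_distr l_minus r_minus a_ac m_assoc)
  also have "\<dots> = \<zero>"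
    using assms(1-3) by (simp add: r_neg)
  finally show ?thesis .
qed

text \<open>The Jacobi identity in derivation form, which expresses a commutator with
  \<open>[x, y]\<close> through iterated commutators with \<open>x\<close> and
  \<open>y\<close>.\<close>

lemma commutator_commutator:
  fixes c
  assumes "x \<in> carrier R" "y \<in> carrier R" "z \<in> carrier R"
  defines "c \<equiv> \<lambda>u v. u \<otimes> v \<ominus> v \<otimes> u"
  shows "c (c x y) z = c x (c y z) \<ominus> c y (c x z)"
proof -
  \<comment> \<open>The two products that cancel on the right: \<open>x z y\<close> and
    \<open>y z x\<close> appear in both double commutators, but not in the expansion of the
    left-hand side.\<close>
  let ?s = "x \<otimes> (z \<otimes> y) \<oplus> y \<otimes> (z \<otimes> x)"
  have "c x (c y z) \<ominus> c y (c x z) = c (c x y) z \<oplus> (?s \<oplus> \<ominus> ?s)"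
    using assms(1-3) unfolding c_def
    by (simp add: a_minus_def minus_add l_distr r_distr l_minus r_minus a_ac m_assoc)
  then show ?thesis
    using assms(1-3) by (simp add: r_neg c_def)
qed

lemma minus_plus_cancel:
  assumes "x \<in> carrier R" "y \<in> carrier R"
  shows "x \<ominus> y \<oplus> y = x"
  using assms by (simp add: a_minus_def a_assoc l_neg)

end

text \<open>Isolates what the argument uses of power series: a scalar \<nu> acting injectively, and
  a subring \<open>H\<close>, stable under scalars, whose commutators are \<nu> times elements of
  \<open>H\<close>. By \<open>nu_cancel\<close>, the equation \<open>nu_br\<close> determines
  \<open>br\<close> on \<open>H\<close>.\<close>

locale rescaled_commutator = assoc_algebra S D for S (structure) and D (structure) +
  fixes \<nu> and H and br
  assumes nu_closed: "\<nu> \<in> carrier S"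
    and nu_cancel:
      "\<lbrakk>x \<in> carrier D; y \<in> carrier D; \<nu> \<odot>\<^bsub>D\<^esub> x = \<nu> \<odot>\<^bsub>D\<^esub> y\<rbrakk> \<Longrightarrow> x = y"
    and H_subring: "subring H D"
    and H_smult: "\<lbrakk>s \<in> carrier S; x \<in> H\<rbrakk> \<Longrightarrow> s \<odot>\<^bsub>D\<^esub> x \<in> H"
    and br_H: "\<lbrakk>x \<in> H; y \<in> H\<rbrakk> \<Longrightarrow> br x y \<in> H"
    and nu_br: "\<lbrakk>x \<in> H; y \<in> H\<rbrakk> \<Longrightarrow> \<nu> \<odot>\<^bsub>D\<^esub> br x y = x \<otimes>\<^bsub>D\<^esub> y \<ominus>\<^bsub>D\<^esub> y \<otimes>\<^bsub>D\<^esub> x"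
begin

lemma H_carrier: "x \<in> H \<Longrightarrow> x \<in> carrier D"
  using subringE(1)[OF H_subring] by auto

lemma br_carrier: "\<lbrakk>x \<in> H; y \<in> H\<rbrakk> \<Longrightarrow> br x y \<in> carrier D"
  by (simp add: H_carrier br_H)

lemmas H_closed = subringE(2,3,5,6,7)[OF H_subring] H_smult br_H

lemma H_ring: "ring (D\<lparr>carrier := H\<rparr>)"
  using H_subring by (rule subring_is_ring)

text \<open>Negation is not a record field but depends on the carrier; uniqueness of inverses shows
  that restriction to \<open>H\<close> does not change it.\<close>

lemma H_a_inv: "x \<in> H \<Longrightarrow> \<ominus>\<^bsub>D\<lparr>carrier := H\<rparr>\<^esub> x = \<ominus>\<^bsub>D\<^esub> x"
proof -
  interpret H: ring "D\<lparr>carrier := H\<rparr>" by (rule H_ring)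
  assume "x \<in> H"
  then show ?thesis
    by (intro H.minus_equality) (simp_all add: H_closed H_carrier M.l_neg)
qed

text \<open>Two factors \<nu> clear both denominators of a nested bracket. The inner bracket lies in
  \<open>H\<close>, so \<open>nu_br\<close> applies to the outer one as well.\<close>

lemma nu_br_br:
  assumes "x \<in> H" "y \<in> H" "z \<in> H"
  shows "\<nu> \<odot>\<^bsub>D\<^esub> (\<nu> \<odot>\<^bsub>D\<^esub> br x (br y z)) =
    x \<otimes>\<^bsub>D\<^esub> (y \<otimes>\<^bsub>D\<^esub> z \<ominus>\<^bsub>D\<^esub> z \<otimes>\<^bsub>D\<^esub> y) \<ominus>\<^bsub>D\<^esub> (y \<otimes>\<^bsub>D\<^esub> z \<ominus>\<^bsub>D\<^esub> z \<otimes>\<^bsub>D\<^esub> y) \<otimes>\<^bsub>D\<^esub> x"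
proof -
  have "\<nu> \<odot>\<^bsub>D\<^esub> (x \<otimes>\<^bsub>D\<^esub> br y z \<ominus>\<^bsub>D\<^esub> br y z \<otimes>\<^bsub>D\<^esub> x)
    = x \<otimes>\<^bsub>D\<^esub> (\<nu> \<odot>\<^bsub>D\<^esub> br y z) \<ominus>\<^bsub>D\<^esub> (\<nu> \<odot>\<^bsub>D\<^esub> br y z) \<otimes>\<^bsub>D\<^esub> x"
    using assms by (simp add: a_minus_def smult_r_distr smult_r_minus nu_closed H_carrier br_carrier
        smult_mult_left smult_mult_right)
  then show ?thesis
    using assms by (simp add: nu_br br_H)
qed

lemma H_assoc_algebra: "assoc_algebra S (D\<lparr>carrier := H\<rparr>)"
proof -
  interpret H: ring "D\<lparr>carrier := H\<rparr>" by (rule H_ring)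
  have "Module.module S (D\<lparr>carrier := H\<rparr>)"
    by (rule moduleI)
      (auto simp: R.is_cring H.is_abelian_group H_smult H_carrier smult_l_distr smult_r_distr smult_assoc1)
  then show ?thesis
    by (intro assoc_algebra.intro assoc_algebra_axioms.intro H_ring)
      (auto simp: H_carrier smult_mult_left smult_mult_right)
qed

text \<open>The device behind the bracket identities below: a candidate value is verified after
  multiplication by \<nu>, as a statement about commutators.\<close>

lemma br_eqI:
  assumes "x \<in> H" "y \<in> H" "z \<in> carrier D"
    and "\<nu> \<odot>\<^bsub>D\<^esub> z = x \<otimes>\<^bsub>D\<^esub> y \<ominus>\<^bsub>D\<^esub> y \<otimes>\<^bsub>D\<^esub> x"
  shows "br x y = z"
  by (rule nu_cancel) (use assms in \<open>simp_all add: br_carrier nu_br\<close>)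

lemma br_smult_r:
  assumes "s \<in> carrier S" "x \<in> H" "y \<in> H"
  shows "br x (s \<odot>\<^bsub>D\<^esub> y) = s \<odot>\<^bsub>D\<^esub> br x y"
proof (rule br_eqI)
  \<comment> \<open>Commutativity of \<open>S\<close> lets \<open>s\<close> and \<nu> change
    places.\<close>
  have "\<nu> \<odot>\<^bsub>D\<^esub> (s \<odot>\<^bsub>D\<^esub> br x y) = s \<odot>\<^bsub>D\<^esub> (\<nu> \<odot>\<^bsub>D\<^esub> br x y)"
    using assms by (simp add: smult_assoc1[symmetric] nu_closed br_carrier R.m_comm)
  then show "\<nu> \<odot>\<^bsub>D\<^esub> (s \<odot>\<^bsub>D\<^esub> br x y) = x \<otimes>\<^bsub>D\<^esub> (s \<odot>\<^bsub>D\<^esub> y) \<ominus>\<^bsub>D\<^esub> (s \<odot>\<^bsub>D\<^esub> y) \<otimes>\<^bsub>D\<^esub> x"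
    using assms by (simp add: nu_br a_minus_def smult_r_distr smult_r_minus H_carrier
        smult_mult_left smult_mult_right)
qed (use assms in \<open>simp_all add: H_closed H_carrier br_carrier\<close>)

lemma br_skew_H:
  assumes "x \<in> H" "y \<in> H"
  shows "br x y = \<ominus>\<^bsub>D\<^esub> br y x"
proof (rule br_eqI)
  have c: "x \<in> carrier D" "y \<in> carrier D" using assms by (simp_all add: H_carrier)
  have "\<ominus>\<^bsub>D\<^esub> (y \<otimes>\<^bsub>D\<^esub> x \<ominus>\<^bsub>D\<^esub> x \<otimes>\<^bsub>D\<^esub> y) = x \<otimes>\<^bsub>D\<^esub> y \<ominus>\<^bsub>D\<^esub> y \<otimes>\<^bsub>D\<^esub> x"
    using c by (rule commutator_skew)
  then show "\<nu> \<odot>\<^bsub>D\<^esub> (\<ominus>\<^bsub>D\<^esub> br y x) = x \<otimes>\<^bsub>D\<^esub> y \<ominus>\<^bsub>D\<^esub> y \<otimes>\<^bsub>D\<^esub> x"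
    using assms by (simp add: smult_r_minus nu_closed br_carrier nu_br)
qed (use assms in \<open>simp_all add: br_carrier\<close>)

lemma br_add_r:
  assumes "x \<in> H" "y \<in> H" "z \<in> H"
  shows "br x (y \<oplus>\<^bsub>D\<^esub> z) = br x y \<oplus>\<^bsub>D\<^esub> br x z"
proof (rule br_eqI)
  have c: "x \<in> carrier D" "y \<in> carrier D" "z \<in> carrier D" using assms by (simp_all add: H_carrier)
  have "x \<otimes>\<^bsub>D\<^esub> y \<ominus>\<^bsub>D\<^esub> y \<otimes>\<^bsub>D\<^esub> x \<oplus>\<^bsub>D\<^esub> (x \<otimes>\<^bsub>D\<^esub> z \<ominus>\<^bsub>D\<^esub> z \<otimes>\<^bsub>D\<^esub> x)
    = x \<otimes>\<^bsub>D\<^esub> (y \<oplus>\<^bsub>D\<^esub> z) \<ominus>\<^bsub>D\<^esub> (y \<oplus>\<^bsub>D\<^esub> z) \<otimes>\<^bsub>D\<^esub> x"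
    using c by (rule commutator_add_right)
  then show "\<nu> \<odot>\<^bsub>D\<^esub> (br x y \<oplus>\<^bsub>D\<^esub> br x z) = x \<otimes>\<^bsub>D\<^esub> (y \<oplus>\<^bsub>D\<^esub> z) \<ominus>\<^bsub>D\<^esub> (y \<oplus>\<^bsub>D\<^esub> z) \<otimes>\<^bsub>D\<^esub> x"
    using assms by (simp add: smult_r_distr nu_closed br_carrier nu_br)
qed (use assms in \<open>simp_all add: H_closed H_carrier br_carrier\<close>)

lemma br_leibniz_H:
  assumes "x \<in> H" "y \<in> H" "z \<in> H"
  shows "br x (y \<otimes>\<^bsub>D\<^esub> z) = br x y \<otimes>\<^bsub>D\<^esub> z \<oplus>\<^bsub>D\<^esub> y \<otimes>\<^bsub>D\<^esub> br x z"
proof (rule br_eqI)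
  have c: "x \<in> carrier D" "y \<in> carrier D" "z \<in> carrier D" using assms by (simp_all add: H_carrier)
  have "(x \<otimes>\<^bsub>D\<^esub> y \<ominus>\<^bsub>D\<^esub> y \<otimes>\<^bsub>D\<^esub> x) \<otimes>\<^bsub>D\<^esub> z \<oplus>\<^bsub>D\<^esub> y \<otimes>\<^bsub>D\<^esub> (x \<otimes>\<^bsub>D\<^esub> z \<ominus>\<^bsub>D\<^esub> z \<otimes>\<^bsub>D\<^esub> x)
    = x \<otimes>\<^bsub>D\<^esub> (y \<otimes>\<^bsub>D\<^esub> z) \<ominus>\<^bsub>D\<^esub> (y \<otimes>\<^bsub>D\<^esub> z) \<otimes>\<^bsub>D\<^esub> x"
    using c by (rule commutator_leibniz)
  moreover have "\<nu> \<odot>\<^bsub>D\<^esub> (br x y \<otimes>\<^bsub>D\<^esub> z) = (\<nu> \<odot>\<^bsub>D\<^esub> br x y) \<otimes>\<^bsub>D\<^esub> z"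
    "\<nu> \<odot>\<^bsub>D\<^esub> (y \<otimes>\<^bsub>D\<^esub> br x z) = y \<otimes>\<^bsub>D\<^esub> (\<nu> \<odot>\<^bsub>D\<^esub> br x z)"
    using assms c by (simp_all add: nu_closed br_carrier smult_mult_left smult_mult_right)
  ultimately show "\<nu> \<odot>\<^bsub>D\<^esub> (br x y \<otimes>\<^bsub>D\<^esub> z \<oplus>\<^bsub>D\<^esub> y \<otimes>\<^bsub>D\<^esub> br x z)
      = x \<otimes>\<^bsub>D\<^esub> (y \<otimes>\<^bsub>D\<^esub> z) \<ominus>\<^bsub>D\<^esub> (y \<otimes>\<^bsub>D\<^esub> z) \<otimes>\<^bsub>D\<^esub> x"
    using assms c by (simp add: smult_r_distr nu_closed br_carrier nu_br)
qed (use assms in \<open>simp_all add: H_closed H_carrier br_carrier\<close>)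

lemma br_jacobi_H:
  assumes "x \<in> H" "y \<in> H" "z \<in> H"
  shows "br x (br y z) \<oplus>\<^bsub>D\<^esub> br y (br z x) \<oplus>\<^bsub>D\<^esub> br z (br x y) = \<zero>\<^bsub>D\<^esub>" (is "?J = _")
proof -
  let ?c = "\<lambda>u v. u \<otimes>\<^bsub>D\<^esub> v \<ominus>\<^bsub>D\<^esub> v \<otimes>\<^bsub>D\<^esub> u"
  have c: "x \<in> carrier D" "y \<in> carrier D" "z \<in> carrier D" using assms by (simp_all add: H_carrier)
  have J: "?J \<in> carrier D"
    using assms by (simp add: br_carrier br_H)
  have "?c x (?c y z) \<oplus>\<^bsub>D\<^esub> ?c y (?c z x) \<oplus>\<^bsub>D\<^esub> ?c z (?c x y) = \<zero>\<^bsub>D\<^esub>"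
    using c by (rule commutator_jacobi)
  \<comment> \<open>Each summand is a nested bracket, so \<nu> is applied twice here and cancelled
    twice afterwards.\<close>
  then have "\<nu> \<odot>\<^bsub>D\<^esub> (\<nu> \<odot>\<^bsub>D\<^esub> ?J) = \<nu> \<odot>\<^bsub>D\<^esub> (\<nu> \<odot>\<^bsub>D\<^esub> \<zero>\<^bsub>D\<^esub>)"
    using assms by (simp add: smult_r_distr nu_closed br_carrier br_H nu_br_br)
  then show ?thesis
    using J nu_closed nu_cancel by (meson smult_closed M.zero_closed)
qed

lemma H_poisson_algebra: "poisson_algebra S (D\<lparr>carrier := H\<rparr>) br"
proof -
  \<comment> \<open>Linearity on the left follows from linearity on the right by skew-symmetry.
    Fixing the second argument of \<open>br_skew_H\<close> keeps the rewriting from looping.\<close>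
  have add_l: "br (x \<oplus>\<^bsub>D\<^esub> y) z = br x z \<oplus>\<^bsub>D\<^esub> br y z" if "x \<in> H" "y \<in> H" "z \<in> H" for x y z
    using that by (simp add: br_skew_H[of _ z] H_closed br_add_r M.minus_add br_carrier M.a_comm)
  have smult_l: "br (s \<odot>\<^bsub>D\<^esub> x) y = s \<odot>\<^bsub>D\<^esub> br x y" if "s \<in> carrier S" "x \<in> H" "y \<in> H" for s x y
    using that by (simp add: br_skew_H[of _ y] H_closed br_smult_r smult_r_minus br_carrier)
  show ?thesis
    by (intro poisson_algebra.intro poisson_algebra_axioms.intro H_assoc_algebra)
      (auto simp: br_H add_l smult_l br_add_r br_smult_r H_a_inv br_jacobi_H br_leibniz_H
        intro: br_skew_H)
qed

section \<open>The Poisson ideal of multiples of \<nu> and its commutative quotient\<close>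

lemma nu_H_poisson_ideal:
  "poisson_ideal S (D\<lparr>carrier := H\<rparr>) br ((\<lambda>x. \<nu> \<odot>\<^bsub>D\<^esub> x) ` H)" (is "poisson_ideal S ?H br ?I")
proof -
  interpret H: ring ?H by (rule H_ring)
  have "subgroup ?I (add_monoid ?H)"
  proof (rule H.add.subgroupI)
    show "?I \<noteq> {}" using H_closed(1) by blast
  next
    fix a assume "a \<in> ?I"
    then obtain x where x: "x \<in> H" "a = \<nu> \<odot>\<^bsub>D\<^esub> x" by auto
    then have "\<ominus>\<^bsub>?H\<^esub> a = \<nu> \<odot>\<^bsub>D\<^esub> (\<ominus>\<^bsub>D\<^esub> x)"
      by (simp add: H_a_inv H_smult nu_closed smult_r_minus H_carrier)
    then show "\<ominus>\<^bsub>?H\<^esub> a \<in> ?I"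
      using x H_closed by auto
  qed (auto simp: H_smult nu_closed smult_r_distr[symmetric] H_carrier intro!: imageI H_closed)
  then have "ideal ?I ?H"
    by (rule idealI[OF H_ring])
      (auto simp: nu_closed smult_mult_left smult_mult_right H_carrier intro!: imageI H_closed)
  \<comment> \<open>The Lie ideal property is linearity over scalars,
    \<open>br b (\<nu> x) = \<nu> (br b x)\<close>, together with the fact that brackets lie in
    \<open>H\<close> and not merely in \<open>D\<close>.\<close>
  then show ?thesis
    by (intro poisson_ideal.intro poisson_ideal_axioms.intro H_poisson_algebra)
      (auto simp: br_smult_r nu_closed br_H)
qed

lemma quot_comm_poisson_algebra:
  "comm_poisson_algebra S (quot_algebra (D\<lparr>carrier := H\<rparr>) ((\<lambda>x. \<nu> \<odot>\<^bsub>D\<^esub> x) ` H))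
     (quot_bracket (D\<lparr>carrier := H\<rparr>) ((\<lambda>x. \<nu> \<odot>\<^bsub>D\<^esub> x) ` H) br)"
  (is "comm_poisson_algebra S (quot_algebra ?H ?I) _")
proof -
  interpret I: poisson_ideal S ?H br ?I by (rule nu_H_poisson_ideal)
  have "K \<otimes>\<^bsub>quot_algebra ?H ?I\<^esub> L = L \<otimes>\<^bsub>quot_algebra ?H ?I\<^esub> K"
    if K: "K \<in> carrier (quot_algebra ?H ?I)" and L: "L \<in> carrier (quot_algebra ?H ?I)" for K L
  proof -
    obtain x where x: "x \<in> H" "K = ?I +>\<^bsub>?H\<^esub> x"
      using I.quot_carrierE[OF K] by auto
    obtain y where y: "y \<in> H" "L = ?I +>\<^bsub>?H\<^esub> y"
      using I.quot_carrierE[OF L] by auto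
    have c: "x \<in> carrier D" "y \<in> carrier D" using x y by (simp_all add: H_carrier)
    have "x \<otimes>\<^bsub>D\<^esub> y = (x \<otimes>\<^bsub>D\<^esub> y \<ominus>\<^bsub>D\<^esub> y \<otimes>\<^bsub>D\<^esub> x) \<oplus>\<^bsub>D\<^esub> y \<otimes>\<^bsub>D\<^esub> x"
      using c by (simp add: minus_plus_cancel)
    also have "\<dots> = \<nu> \<odot>\<^bsub>D\<^esub> br x y \<oplus>\<^bsub>D\<^esub> y \<otimes>\<^bsub>D\<^esub> x"
      using x y by (simp add: nu_br)
    \<comment> \<open>The two products differ by \<nu> times an element of \<open>H\<close>, which
      the coset absorbs.\<close>
    finally have "?I +>\<^bsub>?H\<^esub> (x \<otimes>\<^bsub>D\<^esub> y) = ?I +>\<^bsub>?H\<^esub> (y \<otimes>\<^bsub>D\<^esub> x)"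
      using I.coset_absorb[of "\<nu> \<odot>\<^bsub>D\<^esub> br x y" "y \<otimes>\<^bsub>D\<^esub> x"] x y by (simp add: br_H H_closed)
    then show ?thesis
      using x y I.quot_ops(2)[of x y] I.quot_ops(2)[of y x] by simp
  qed
  then show ?thesis
    by (intro comm_poisson_algebra.intro comm_poisson_algebra_axioms.intro I.quot_poisson_algebra)
qed

end

section \<open>Formal deformations\<close>

context formal_deformation
begin

abbreviation D where "D \<equiv> fps_algebra A star e"
text \<open>The description by constant terms is the convenient one for closure proofs;
  \<open>H_nu_eq\<close> identifies it with the carrier of \<open>H_nu\<close>.\<close>

abbreviation H where "H \<equiv> {F \<in> carrier D. F 0 \<in> ring_center A}"
abbreviation comm where "comm F G \<equiv> F \<otimes>\<^bsub>D\<^esub> G \<ominus>\<^bsub>D\<^esub> G \<otimes>\<^bsub>D\<^esub> F"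

section \<open>Coefficients of series and division by \<nu>\<close>

lemma D_carrier: "F \<in> carrier D \<longleftrightarrow> (\<forall>n. F n \<in> carrier A)"
  by (simp add: fps_algebra_def)

lemma D_add: "(F \<oplus>\<^bsub>D\<^esub> G) n = F n \<oplus>\<^bsub>A\<^esub> G n"
  by (simp add: fps_algebra_def)

lemma D_zero: "\<zero>\<^bsub>D\<^esub> n = \<zero>\<^bsub>A\<^esub>"
  by (simp add: fps_algebra_def)

lemma coeff_closed: "F \<in> carrier D \<Longrightarrow> F n \<in> carrier A"
  by (simp add: D_carrier)

text \<open>Addition in \<open>D\<close> is coefficientwise by definition; negation inherits this
  from uniqueness of additive inverses.\<close>

lemma D_a_inv:
  assumes "F \<in> carrier D"
  shows "(\<ominus>\<^bsub>D\<^esub> F) n = \<ominus>\<^bsub>A\<^esub> F n"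
proof -
  have "\<ominus>\<^bsub>D\<^esub> F = (\<lambda>n. \<ominus>\<^bsub>A\<^esub> F n)"
    using assms by (intro star.minus_equality) (auto simp: D_carrier D_add D_zero l_neg)
  then show ?thesis by simp
qed

lemma D_minus:
  "\<lbrakk>F \<in> carrier D; G \<in> carrier D\<rbrakk> \<Longrightarrow> (F \<ominus>\<^bsub>D\<^esub> G) n = F n \<ominus>\<^bsub>A\<^esub> G n"
  by (simp add: a_minus_def D_add D_a_inv)

lemma fps_const_closed: "a \<in> carrier A \<Longrightarrow> fps_const A a \<in> carrier D"
  by (simp add: D_carrier fps_const_def)

lemma fps_nu_closed: "fps_nu R \<in> carrier (fps_ring R)"
  by (simp add: fps_nu_def fps_ring_def)

lemma smult_0:
  assumes "f \<in> carrier (fps_ring R)" "F \<in> carrier D"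
  shows "(f \<odot>\<^bsub>D\<^esub> F) 0 = f 0 \<odot>\<^bsub>A\<^esub> F 0"
  using assms by (simp add: fps_algebra_def fps_ring_def)

lemma nu_smult_0: "F \<in> carrier D \<Longrightarrow> (fps_nu R \<odot>\<^bsub>D\<^esub> F) 0 = \<zero>\<^bsub>A\<^esub>"
  by (simp add: smult_0 fps_nu_closed coeff_closed) (simp add: fps_nu_def coeff_closed)

lemma nu_smult_Suc:
  assumes "F \<in> carrier D"
  shows "(fps_nu R \<odot>\<^bsub>D\<^esub> F) (Suc n) = F n"
proof -
  have "(fps_nu R \<odot>\<^bsub>D\<^esub> F) (Suc n) = (\<Oplus>\<^bsub>A\<^esub>i\<in>{..Suc n}. fps_nu R i \<odot>\<^bsub>A\<^esub> F (Suc n - i))"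
    by (simp add: fps_algebra_def)
  \<comment> \<open>Only the index 1 contributes to the Cauchy sum, so \<nu> shifts coefficients up
    by one. The test is written \<open>1 = i\<close> to match
    \<open>finprod_singleton\<close>.\<close>
  also have "\<dots> = (\<Oplus>\<^bsub>A\<^esub>i\<in>{..Suc n}. if 1 = i then F (Suc n - i) else \<zero>\<^bsub>A\<^esub>)"
    using assms by (intro finsum_cong') (auto simp: fps_nu_def coeff_closed)
  also have "\<dots> = F n"
    using assms add.finprod_singleton[of 1 "{..Suc n}" "\<lambda>i. F (Suc n - i)"]
    by (simp add: coeff_closed finsum_def)
  finally show ?thesis .
qed

lemma nu_smult_cancel:
  assumes "F \<in> carrier D" "G \<in> carrier D" "fps_nu R \<odot>\<^bsub>D\<^esub> F = fps_nu R \<odot>\<^bsub>D\<^esub> G"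
  shows "F = G"
  using assms nu_smult_Suc by (metis ext)

text \<open>The quotient by \<nu> is the sequence shifted down by one; the vanishing constant term
  is exactly what this shift loses.\<close>

lemma nu_divisible:
  assumes "F \<in> carrier D" "F 0 = \<zero>\<^bsub>A\<^esub>"
  obtains G where "G \<in> carrier D" "fps_nu R \<odot>\<^bsub>D\<^esub> G = F"
proof
  show G: "(\<lambda>n. F (Suc n)) \<in> carrier D"
    using assms by (simp add: D_carrier)
  show "fps_nu R \<odot>\<^bsub>D\<^esub> (\<lambda>n. F (Suc n)) = F"
  proof
    fix n show "(fps_nu R \<odot>\<^bsub>D\<^esub> (\<lambda>n. F (Suc n))) n = F n"
      using G assms by (cases n) (simp_all add: nu_smult_0 nu_smult_Suc)
  qed
qed

lemma const_plus_nu: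
  assumes "F \<in> carrier D"
  obtains G where "G \<in> carrier D" "F = fps_const A (F 0) \<oplus>\<^bsub>D\<^esub> fps_nu R \<odot>\<^bsub>D\<^esub> G"
proof -
  have c: "fps_const A (F 0) \<in> carrier D"
    using assms by (simp add: fps_const_closed coeff_closed)
  have "(F \<ominus>\<^bsub>D\<^esub> fps_const A (F 0)) 0 = \<zero>\<^bsub>A\<^esub>"
    using assms c by (simp add: D_minus) (simp add: fps_const_def a_minus_def r_neg coeff_closed)
  then obtain G where G: "G \<in> carrier D" "fps_nu R \<odot>\<^bsub>D\<^esub> G = F \<ominus>\<^bsub>D\<^esub> fps_const A (F 0)"
    using assms c nu_divisible by (metis star.minus_closed)
  then have "F = fps_const A (F 0) \<oplus>\<^bsub>D\<^esub> fps_nu R \<odot>\<^bsub>D\<^esub> G"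
    using assms c by (metis star.minus_plus_cancel star.a_comm star.minus_closed)
  with G that show ?thesis by blast
qed

section \<open>Constant terms of products\<close>

lemma const_mult_const_0:
  assumes "a \<in> carrier A" "b \<in> carrier A"
  shows "(fps_const A a \<otimes>\<^bsub>D\<^esub> fps_const A b) 0 = a \<otimes>\<^bsub>A\<^esub> b"
proof -
  have p: "fps_const A a \<otimes>\<^bsub>D\<^esub> fps_const A b \<in> carrier D"
    using assms by (simp add: fps_const_closed)
  \<comment> \<open>The deformation condition enters here: the product of two constants differs from
    their product in \<open>A\<close> by a multiple of \<nu>, which has no constant term.\<close>
  obtain G where "G \<in> carrier D"
    "fps_const A a \<otimes>\<^bsub>D\<^esub> fps_const A b \<ominus>\<^bsub>D\<^esub> fps_const A (a \<otimes>\<^bsub>A\<^esub> b) = fps_nu R \<odot>\<^bsub>D\<^esub> G"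
    using star_mod_nu[OF assms] by (auto simp: nu_multiples_def fps_algebra_def)
  then have "(fps_const A a \<otimes>\<^bsub>D\<^esub> fps_const A b) 0 \<ominus>\<^bsub>A\<^esub> fps_const A (a \<otimes>\<^bsub>A\<^esub> b) 0 = \<zero>\<^bsub>A\<^esub>"
    using assms p by (metis D_minus fps_const_closed m_closed nu_smult_0)
  then show ?thesis
    using assms coeff_closed[OF p] minus_plus_cancel
    by (metis (no_types, lifting) fps_const_def l_zero m_closed)
qed

text \<open>Both factors are split into a constant and a multiple of \<nu>. By bilinearity over the
  power series ring, every product involving a \<nu>-part is again a multiple of \<nu>, so only the
  two constants contribute.\<close>

lemma mult_0:
  assumes F: "F \<in> carrier D" and G: "G \<in> carrier D"
  shows "(F \<otimes>\<^bsub>D\<^esub> G) 0 = F 0 \<otimes>\<^bsub>A\<^esub> G 0"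
proof -
  have eq_0: "(X \<oplus>\<^bsub>D\<^esub> fps_nu R \<odot>\<^bsub>D\<^esub> Y) 0 = X 0" if "X \<in> carrier D" "Y \<in> carrier D" for X Y
    using that by (simp add: D_add nu_smult_0 coeff_closed)
  obtain F' where F': "F' \<in> carrier D" "F = fps_const A (F 0) \<oplus>\<^bsub>D\<^esub> fps_nu R \<odot>\<^bsub>D\<^esub> F'"
    using F by (rule const_plus_nu)
  obtain G' where G': "G' \<in> carrier D" "G = fps_const A (G 0) \<oplus>\<^bsub>D\<^esub> fps_nu R \<odot>\<^bsub>D\<^esub> G'"
    using G by (rule const_plus_nu)
  have c: "fps_const A (F 0) \<in> carrier D" "fps_const A (G 0) \<in> carrier D"
    using F G by (simp_all add: fps_const_closed coeff_closed)
  have "F \<otimes>\<^bsub>D\<^esub> G = fps_const A (F 0) \<otimes>\<^bsub>D\<^esub> G \<oplus>\<^bsub>D\<^esub> fps_nu R \<odot>\<^bsub>D\<^esub> (F' \<otimes>\<^bsub>D\<^esub> G)"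
    using F' c G by (metis star.l_distr star.smult_mult_left star.smult_closed fps_nu_closed)
  moreover have "fps_const A (F 0) \<otimes>\<^bsub>D\<^esub> G = fps_const A (F 0) \<otimes>\<^bsub>D\<^esub> fps_const A (G 0)
      \<oplus>\<^bsub>D\<^esub> fps_nu R \<odot>\<^bsub>D\<^esub> (fps_const A (F 0) \<otimes>\<^bsub>D\<^esub> G')"
    using G' c by (metis star.r_distr star.smult_mult_right star.smult_closed fps_nu_closed)
  ultimately have "(F \<otimes>\<^bsub>D\<^esub> G) 0 = (fps_const A (F 0) \<otimes>\<^bsub>D\<^esub> fps_const A (G 0)) 0"
    using F'(1) G'(1) c G by (metis eq_0 star.m_closed)
  then show ?thesis
    using F G by (simp add: const_mult_const_0 coeff_closed)
qed

text \<open>The unit of \<open>D\<close> may have higher coefficients, but its product with the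
  constant series at the unit of \<open>A\<close> is that series; constant terms are then compared
  by \<open>mult_0\<close>.\<close>

lemma unit_0: "\<one>\<^bsub>D\<^esub> 0 = \<one>\<^bsub>A\<^esub>"
proof -
  have "\<one>\<^bsub>D\<^esub> 0 \<otimes>\<^bsub>A\<^esub> \<one>\<^bsub>A\<^esub> = fps_const A \<one>\<^bsub>A\<^esub> 0"
    using mult_0[of "\<one>\<^bsub>D\<^esub>" "fps_const A \<one>\<^bsub>A\<^esub>"] by (simp add: fps_const_closed) (simp add: fps_const_def)
  then show ?thesis
    using coeff_closed[OF star.one_closed, of 0] by (simp add: fps_const_def)
qed

section \<open>Series with central constant term\<close>

lemma center_subring: "subring (ring_center A) A"
proof (rule subringI)
  fix z w assume z: "z \<in> ring_center A" and w: "w \<in> ring_center A"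
  have c: "z \<in> carrier A" "w \<in> carrier A"
    using z w by (auto simp: ring_center_def)
  have zx: "z \<otimes>\<^bsub>A\<^esub> x = x \<otimes>\<^bsub>A\<^esub> z" and wx: "w \<otimes>\<^bsub>A\<^esub> x = x \<otimes>\<^bsub>A\<^esub> w"
    if "x \<in> carrier A" for x
    using that z w by (auto simp: ring_center_def)
  have "z \<otimes>\<^bsub>A\<^esub> w \<otimes>\<^bsub>A\<^esub> x = x \<otimes>\<^bsub>A\<^esub> (z \<otimes>\<^bsub>A\<^esub> w)" if "x \<in> carrier A" for x
    using that c zx wx by (metis m_assoc)
  with c show "z \<otimes>\<^bsub>A\<^esub> w \<in> ring_center A"
    by (simp add: ring_center_def)
  show "z \<oplus>\<^bsub>A\<^esub> w \<in> ring_center A"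
    using z w by (simp add: ring_center_def l_distr r_distr)
qed (auto simp: ring_center_def l_minus r_minus)

text \<open>Taking the constant term is a ring homomorphism from \<open>D\<close> to
  \<open>A\<close>, and \<open>H\<close> is the preimage of the center.\<close>

lemma H_subring: "subring H D"
proof -
  note Z = subringE[OF center_subring]
  show ?thesis
    by (rule star.subringI) (simp_all add: D_a_inv D_add mult_0 unit_0 Z(3,5,6,7) subset_iff)
qed

text \<open>A scalar series acts on constant terms through \<open>f 0\<close>, and bilinearity of
  the product keeps scalar multiples of central elements central.\<close>

lemma H_smult:
  assumes "f \<in> carrier (fps_ring R)" "F \<in> H"
  shows "f \<odot>\<^bsub>D\<^esub> F \<in> H"
proof -
  have "f 0 \<in> carrier R"
    using assms by (simp add: fps_ring_def)
  then show ?thesis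
    using assms by (auto simp: smult_0 ring_center_def smult_mult_left smult_mult_right)
qed

text \<open>One central constant term suffices. The other series is arbitrary, which
  \<open>comm_divisible\<close> needs for its test series.\<close>

lemma comm_0:
  assumes "F \<in> H" "G \<in> carrier D"
  shows "comm F G 0 = \<zero>\<^bsub>A\<^esub>"
proof -
  have "comm F G 0 = F 0 \<otimes>\<^bsub>A\<^esub> G 0 \<ominus>\<^bsub>A\<^esub> G 0 \<otimes>\<^bsub>A\<^esub> F 0"
    using assms by (simp add: D_minus mult_0)
  then show ?thesis
    using assms by (simp add: coeff_closed ring_center_def a_minus_def r_neg)
qed

lemma nu_comm_left:
  assumes "F \<in> carrier D" "G \<in> carrier D"
  shows "comm (fps_nu R \<odot>\<^bsub>D\<^esub> F) G = fps_nu R \<odot>\<^bsub>D\<^esub> comm F G"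
  using assms by (simp add: a_minus_def fps_nu_closed star.smult_mult_left star.smult_mult_right
      star.smult_r_distr star.smult_r_minus)

lemma nu_comm_right:
  assumes "F \<in> carrier D" "G \<in> carrier D"
  shows "comm F (fps_nu R \<odot>\<^bsub>D\<^esub> G) = fps_nu R \<odot>\<^bsub>D\<^esub> comm F G"
  using assms by (simp add: a_minus_def fps_nu_closed star.smult_mult_left star.smult_mult_right
      star.smult_r_distr star.smult_r_minus)

text \<open>
  Commutators with elements of \<open>H\<close> lie in \<open>\<nu> A[[\<nu>]]\<close>. So for \<open>K \<in> A[[\<nu>]]\<close>, both \<open>[F, [G, K]]\<close> and \<open>[G, [F, K]]\<close> lie
  in \<open>\<nu>\<^sup>2 A[[\<nu>]]\<close>, hence so does
  \<open>[[F, G], K] = \<nu> [C, K]\<close>; therefore the constant term of \<open>C\<close> is central.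
\<close>

lemma comm_divisible:
  assumes F: "F \<in> H" and G: "G \<in> H"
  obtains C where "C \<in> H" "fps_nu R \<odot>\<^bsub>D\<^esub> C = comm F G"
proof -
  have c: "F \<in> carrier D" "G \<in> carrier D"
    using F G by auto
  obtain C where C: "C \<in> carrier D" "fps_nu R \<odot>\<^bsub>D\<^esub> C = comm F G"
    using c comm_0[OF F] by (rule_tac F = "comm F G" in nu_divisible) auto
  have "C 0 \<otimes>\<^bsub>A\<^esub> a = a \<otimes>\<^bsub>A\<^esub> C 0" if a: "a \<in> carrier A" for a
  proof -
    \<comment> \<open>The constant series lifts \<open>a\<close> to \<open>D\<close>; by
      \<open>mult_0\<close> the commutator of \<open>C\<close> and \<open>K\<close> has constant
      term \<open>C 0 a - a C 0\<close>.\<close>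
    define K where "K = fps_const A a"
    have K: "K \<in> carrier D" "K 0 = a"
      using a by (simp_all add: K_def fps_const_closed) (simp add: fps_const_def)
    obtain P where P: "P \<in> carrier D" "fps_nu R \<odot>\<^bsub>D\<^esub> P = comm G K"
      using c K comm_0[OF G] by (rule_tac F = "comm G K" in nu_divisible) auto
    obtain Q where Q: "Q \<in> carrier D" "fps_nu R \<odot>\<^bsub>D\<^esub> Q = comm F K"
      using c K comm_0[OF F] by (rule_tac F = "comm F K" in nu_divisible) auto
    have "fps_nu R \<odot>\<^bsub>D\<^esub> comm C K = comm (comm F G) K"
      using nu_comm_left[OF C(1) K(1)] C(2) by simp
    also have "\<dots> = comm F (comm G K) \<ominus>\<^bsub>D\<^esub> comm G (comm F K)"
      using c K by (intro star.commutator_commutator)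
    also have "\<dots> = fps_nu R \<odot>\<^bsub>D\<^esub> (comm F P \<ominus>\<^bsub>D\<^esub> comm G Q)"
      using nu_comm_right[OF c(1) P(1)] nu_comm_right[OF c(2) Q(1)] P Q c
      by (simp add: a_minus_def[of D "comm F P"] a_minus_def[of D "_ \<odot>\<^bsub>D\<^esub> comm F P"]
          star.smult_r_distr star.smult_r_minus fps_nu_closed)
    finally have "comm C K = comm F P \<ominus>\<^bsub>D\<^esub> comm G Q"
      by (rule nu_smult_cancel[rotated 2]) (use c C K P Q in auto)
    then have "comm C K 0 = \<zero>\<^bsub>A\<^esub>"
      using c P Q comm_0[OF F P(1)] comm_0[OF G Q(1)] by (simp add: D_minus a_minus_def[of A "\<zero>\<^bsub>A\<^esub>"])
    then have "C 0 \<otimes>\<^bsub>A\<^esub> a \<ominus>\<^bsub>A\<^esub> a \<otimes>\<^bsub>A\<^esub> C 0 = \<zero>\<^bsub>A\<^esub>"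
      using C K by (simp add: D_minus mult_0)
    then show ?thesis
      using a coeff_closed[OF C(1), of 0] minus_plus_cancel[of "C 0 \<otimes>\<^bsub>A\<^esub> a" "a \<otimes>\<^bsub>A\<^esub> C 0"] by simp
  qed
  then have "C \<in> H"
    using C coeff_closed[OF C(1), of 0] by (simp add: ring_center_def)
  with C that show ?thesis by blast
qed

section \<open>The rescaled bracket and the identification of \<open>H_nu\<close>\<close>

lemma bracket_nu_spec:
  assumes "F \<in> H" "G \<in> H"
  shows "bracket_nu R A star e F G \<in> H"
    and "fps_nu R \<odot>\<^bsub>D\<^esub> bracket_nu R A star e F G = comm F G"
proof -
  obtain C where C: "C \<in> H" "fps_nu R \<odot>\<^bsub>D\<^esub> C = comm F G"
    using assms by (rule comm_divisible)
  have "star X Y = X \<otimes>\<^bsub>D\<^esub> Y" for X Y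
    by (simp add: fps_algebra_def)
  then have "bracket_nu R A star e F G
      = (THE C. C \<in> carrier D \<and> fps_nu R \<odot>\<^bsub>D\<^esub> C = comm F G)"
    by (simp add: bracket_nu_def Let_def)
  also have "\<dots> = C"
    \<comment> \<open>Existence of the quotient by \<nu> comes from \<open>comm_divisible\<close>,
      uniqueness from \<open>nu_smult_cancel\<close>; hence the description denotes
      \<open>C\<close>, which lies in \<open>H\<close>.\<close>
    by (rule the_equality) (use C nu_smult_cancel[of _ C] in auto)
  finally have "bracket_nu R A star e F G = C" .
  with C show "bracket_nu R A star e F G \<in> H"
    and "fps_nu R \<odot>\<^bsub>D\<^esub> bracket_nu R A star e F G = comm F G" by simp_all
qed

lemma rescaled_commutator_bracket_nu:
  "rescaled_commutator (fps_ring R) D (fps_nu R) H (bracket_nu R A star e)"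
  by (intro rescaled_commutator.intro rescaled_commutator_axioms.intro star.assoc_algebra_axioms)
    (rule fps_nu_closed H_subring H_smult bracket_nu_spec nu_smult_cancel; assumption)+

text \<open>Adding a multiple of \<nu> does not change a constant term; conversely
  \<open>const_plus_nu\<close> splits any series into its constant term and a multiple of
  \<nu>.\<close>

lemma H_nu_eq: "H_nu R A star e = D\<lparr>carrier := H\<rparr>"
proof -
  have "(fps_const A ` ring_center A) <+>\<^bsub>D\<^esub> nu_multiples R D (carrier D) = H" (is "?S = H")
  proof
    show "?S \<subseteq> H"
      by (auto simp: set_add_def' nu_multiples_def D_add nu_smult_0 ring_center_def
          fps_const_closed fps_nu_closed) (auto simp: fps_const_def)
    show "H \<subseteq> ?S"
    proof
      fix F assume F: "F \<in> H"
      then obtain G where "G \<in> carrier D" "F = fps_const A (F 0) \<oplus>\<^bsub>D\<^esub> fps_nu R \<odot>\<^bsub>D\<^esub> G"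
        using const_plus_nu by blast
      with F show "F \<in> ?S"
        unfolding set_add_def' nu_multiples_def by blast
    qed
  qed
  then show ?thesis
    by (simp add: H_nu_def Let_def)
qed

lemma nu_H_nu_eq: "nu_H_nu R A star e = (\<lambda>F. fps_nu R \<odot>\<^bsub>D\<^esub> F) ` H"
  by (simp add: nu_H_nu_def nu_multiples_def H_nu_eq)

end

theorem proposition2p9:
  fixes R :: "('r, 'n) ring_scheme"
    and A :: "('r, 'a, 'm) module_scheme"
    and star :: "(nat \<Rightarrow> 'a) \<Rightarrow> (nat \<Rightarrow> 'a) \<Rightarrow> nat \<Rightarrow> 'a"
    and e :: "nat \<Rightarrow> 'a"
  assumes "cring R"
    and "assoc_algebra R A"
    and "formal_deformation R A star e"
  shows "poisson_ideal (fps_ring R) (H_nu R A star e) (bracket_nu R A star e) (nu_H_nu R A star e)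
    \<and> comm_poisson_algebra (fps_ring R)
          (quot_algebra (H_nu R A star e) (nu_H_nu R A star e))
          (quot_bracket (H_nu R A star e) (nu_H_nu R A star e) (bracket_nu R A star e))"
proof -
  interpret formal_deformation R A star e by fact
  interpret rescaled_commutator "fps_ring R" D "fps_nu R" H "bracket_nu R A star e"
    by (rule rescaled_commutator_bracket_nu)
  \<comment> \<open>Rewriting by \<open>H_nu_eq\<close> and \<open>nu_H_nu_eq\<close> turns both
    claims into the general results on rescaled commutators, with \<open>fps_nu R\<close> as the
    parameter.\<close>
  show ?thesis
    using nu_H_poisson_ideal quot_comm_poisson_algebra by (simp add: H_nu_eq nu_H_nu_eq)
qed

end
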